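(* Let $q$ be a prime power, $N$ a positive integer, and $\sigma\in\mathbb{F}_{q^N}$ with $\mathbb{F}_q(\sigma)=\mathbb{F}_{q^N}$. Let $r\ge 1$ and let $a_{i,1},a_{i,2}$ ($1\le i\le r$) be integers with \[ N>a_{1,1}>a_{1,2}\ge a_{2,1}>a_{2,2}\ge \cdots \ge a_{r,1}>a_{r,2}\ge 0, \] and set $a_{0,1}=a_{0,2}=N$, $a_{r+1,1}=a_{r+1,2}=0$. Then \[ \bigl|[(a_{1,1},a_{1,2}),\ldots,(a_{r,1},a_{r,2})]\bigr| =\frac{\binom{N}{1}_q}{\binom{a_{1,1}}{1}_q}\cdot \frac{\prod_{i=0}^{r-1}\binom{a_{i,1}-a_{i+1,1}-1}{a_{i+1,1}-a_{i+1,2}-1}_q\binom{a_{i+1,1}}{a_{i+1,2}}_q\binom{a_{i+1,2}}{a_{i+2,1}}_q}{\prod_{i=1}^{r-1}\binom{a_{i,1}-1}{a_{i+1,1}-1}_q}\; q^{E}, \qquad E=\sum_{i=1}^r (a_{i,1}-a_{i,2})(a_{i,1}-a_{i,2}-1). \]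
   Context: $\mathbb{F}_{q^N}$ is regarded as an $N$-dimensional vector space over $\mathbb{F}_q$; all subspaces are $\mathbb{F}_q$-subspaces. For a subspace $W$, $\sigma W=\{\sigma w: w\in W\}$ and $\sigma^{-1}W=\{\sigma^{-1}w:w\in W\}$. For integers $a,b$ with $N>a>b\ge 0$ or $a=b=0$, $(a,b)$ denotes the set of subspaces $W\subseteq\mathbb{F}_{q^N}$ with $\dim W=a$ and $\dim(W\cap\sigma^{-1}W)=b$. For sets $A_1,\dots,A_k$ of subspaces, $[A_1,\dots,A_k]$ denotes the set of $k$-tuples $(W_1,\dots,W_k)$ with $W_i\in A_i$ for all $i$ and $W_i\supseteq W_{i+1}+\sigma W_{i+1}$ for $1\le i\le k-1$. The Gaussian binomial coefficient $\binom{n}{k}_q$ equals $\prod_{i=0}^{k-1}\frac{1-q^{n-i}}{1-q^{i+1}}$ for integers $0\le k\le n$ (the number of $k$-dimensional subspaces of $\mathbb{F}_q^n$), and is $0$ if $k<0$ or $k>n\ge 0$. *)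

theory Defs
  imports Complex_Main "HOL-Algebra.Algebra" "HOL-Number_Theory.Prime_Powers"
begin

text \<open>
  The extension of finite fields is a HOL-Algebra field \<open>L\<close> with a subfield \<open>K\<close>.
  The \<open>K\<close>-linear subspaces \<open>W\<close> of \<open>L\<close> are the sets with \<open>subalgebra K W L\<close> (despite its name,
  this library predicate asks for an additive subgroup closed under scalars from \<open>K\<close>),
  and \<open>ring.dim L K W\<close> is the dimension of \<open>W\<close> over \<open>K\<close>.
\<close>

definition subspaces_of_type ::
  "('a, 'b) ring_scheme \<Rightarrow> 'a set \<Rightarrow> 'a \<Rightarrow> nat \<Rightarrow> nat \<Rightarrow> 'a set set" where
  "subspaces_of_type L K \<sigma> a b =
     {W. subalgebra K W L \<and> ring.dim L K W = a \<and>
         ring.dim L K (W \<inter> (inv\<^bsub>L\<^esub> \<sigma> <#\<^bsub>L\<^esub> W)) = b}"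

text \<open>
  The set \<open>[A\<^sub>1, \<dots>, A\<^sub>k]\<close>.  A tuple is a list, so \<open>W\<^sub>i\<close> is \<open>Ws ! (i - 1)\<close>.
\<close>

definition subspace_chains ::
  "('a, 'b) ring_scheme \<Rightarrow> 'a \<Rightarrow> 'a set set list \<Rightarrow> 'a set list set" where
  "subspace_chains L \<sigma> As =
     {Ws. length Ws = length As \<and>
          (\<forall>i < length As. Ws ! i \<in> As ! i) \<and>
          (\<forall>i. Suc i < length As \<longrightarrow>
             Ws ! Suc i <+>\<^bsub>L\<^esub> (\<sigma> <#\<^bsub>L\<^esub> Ws ! Suc i) \<subseteq> Ws ! i)}"

text \<open>
  The Gaussian binomial coefficient for \<open>n, k \<ge> 0\<close>.
\<close>

definition gauss_binomial :: "real \<Rightarrow> nat \<Rightarrow> nat \<Rightarrow> real" where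
  "gauss_binomial q n k =
     (if k \<le> n then \<Prod>i<k. (1 - q ^ (n - i)) / (1 - q ^ (i + 1)) else 0)"

end

theory Submission
  imports Defs
begin

text \<open>
  For a subspace \<open>W\<close> let \<open>D W = W \<inter> \<sigma>\<inverse> W\<close>, so that \<open>Y + \<sigma> Y \<subseteq> W\<close> iff \<open>Y \<subseteq> D W\<close>.  The claim says that
  among all chains with prescribed types up to \<open>W\<close> of type \<open>(n, d)\<close>, a random \<open>a\<close>-dimensional subspace
  of \<open>D W\<close> has type \<open>(a, k)\<close> with a probability that depends only on \<open>n, a, k\<close> and equals the
  probability for a random \<open>a\<close>-dimensional subspace of an extension of degree \<open>n\<close>.

  Fix the members of a chain before and after some \<open>W\<close> of dimension \<open>a\<close>, say \<open>Z\<close> and \<open>Y\<close>.  The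
  possible \<open>W\<close> are the spaces between \<open>Y + \<sigma> Y\<close> and \<open>D Z\<close>, whose number depends only on the types
  of \<open>Z\<close> and \<open>Y\<close> as soon as there is one.  Hence the sum over the types \<open>(a, k)\<close> of \<open>W\<close> is a fixed
  multiple of the corresponding sum for \<open>W = D Z\<close>.  As there are no invariant subspaces, \<open>k < a\<close>, and
  these linear relations determine all numbers of chains.  By the \<open>q\<close>-Vandermonde identity,
  the claimed numbers satisfy the same relations.
\<close>

section \<open>Gaussian binomial coefficients\<close>

text \<open>Up to the power \<open>(1 - q) ^ n\<close> this is the q-factorial; that power cancels
  in Gaussian binomials.\<close>

definition q_fact :: "real \<Rightarrow> nat \<Rightarrow> real" where
  "q_fact q n = (\<Prod>i<n. (1 - q ^ (i + 1)))"

lemma q_fact_0 [simp]: "q_fact q 0 = 1"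
  and q_fact_Suc: "q_fact q (Suc n) = q_fact q n * (1 - q ^ Suc n)"
  by (simp_all add: q_fact_def)

lemma q_fact_nonzero [simp]:
  assumes "q > 1"
  shows "q_fact q n \<noteq> 0"
proof -
  have "1 - q ^ (i + 1) \<noteq> 0" for i
    using one_less_power[OF assms, of "i + 1"] by simp
  then show ?thesis by (simp add: q_fact_def)
qed

lemma gauss_binomial_q_fact:
  assumes "q > 1" "k \<le> n"
  shows "gauss_binomial q n k = q_fact q n / (q_fact q k * q_fact q (n - k))"
proof -
  have "(\<Prod>i<k. (1 - q ^ (n - i))) * q_fact q (n - k) = q_fact q n"
    using assms(2)
  proof (induction k)
    case (Suc k)
    have "n - k = Suc (n - Suc k)" using Suc.prems by simp
    then have "q_fact q (n - k) = q_fact q (n - Suc k) * (1 - q ^ (n - k))"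
      by (metis q_fact_Suc)
    then show ?case using Suc by (simp add: mult_ac)
  qed simp
  moreover have "gauss_binomial q n k =
      (\<Prod>i<k. (1 - q ^ (n - i))) * q_fact q (n - k) / (q_fact q k * q_fact q (n - k))"
    using assms by (simp add: gauss_binomial_def q_fact_def[of q k] prod_dividef)
  ultimately show ?thesis by simp
qed

lemma gauss_binomial_eq_0: "n < k \<Longrightarrow> gauss_binomial q n k = 0"
  and gauss_binomial_0_right [simp]: "gauss_binomial q n 0 = 1"
  by (simp_all add: gauss_binomial_def)

lemma gauss_binomial_self [simp]: "q > 1 \<Longrightarrow> gauss_binomial q n n = 1"
  by (simp add: gauss_binomial_q_fact)

lemma gauss_binomial_nonzero: "q > 1 \<Longrightarrow> k \<le> n \<Longrightarrow> gauss_binomial q n k \<noteq> 0"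
  by (simp add: gauss_binomial_q_fact)

lemma gauss_binomial_symmetric:
  "q > 1 \<Longrightarrow> k \<le> n \<Longrightarrow> gauss_binomial q n k = gauss_binomial q n (n - k)"
  by (simp add: gauss_binomial_q_fact mult_ac)

text \<open>Both sides count the flags of dimensions \<open>b\<close>, \<open>k\<close> in an
  \<open>a\<close>-dimensional space, choosing either member first.\<close>

lemma gauss_binomial_subset:
  "q > 1 \<Longrightarrow> b \<le> k \<Longrightarrow> k \<le> a \<Longrightarrow>
    gauss_binomial q a k * gauss_binomial q k b =
    gauss_binomial q a b * gauss_binomial q (a - b) (k - b)"
  by (simp add: gauss_binomial_q_fact)

text \<open>The analogue of \<open>k * binom(n, k) = n * binom(n - 1, k - 1)\<close>. For
  \<open>n < k\<close> both sides vanish, at \<open>n = 0\<close> thanks to the factor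
  \<open>q ^ n - 1\<close>.\<close>

lemma gauss_binomial_absorb:
  assumes "q > 1" "0 < k"
  shows "gauss_binomial q n k * (q ^ k - 1) = gauss_binomial q (n - 1) (k - 1) * (q ^ n - 1)"
proof (cases "k \<le> n")
  case True
  obtain m where m: "n = k + m" using True le_Suc_ex by blast
  obtain l where l: "k = Suc l" using assms(2) gr0_implies_Suc by blast
  have "q_fact q k \<noteq> 0" "q_fact q l \<noteq> 0" "q_fact q m \<noteq> 0" using assms(1) by simp_all
  then show ?thesis
    using assms(1) unfolding m l
    by (simp add: gauss_binomial_q_fact q_fact_Suc divide_simps del: power_Suc) (simp add: algebra_simps)
next
  case False
  then show ?thesis using assms(2) by (cases n) (simp_all add: gauss_binomial_eq_0)
qed

lemma gauss_binomial_Suc: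
  assumes "q > 1"
  shows "gauss_binomial q (Suc n) (Suc k) =
    gauss_binomial q n k + q ^ Suc k * gauss_binomial q n (Suc k)"
proof -
  consider "n < k" | "n = k" | m where "n = Suc k + m"
    by (metis less_iff_Suc_add linorder_neqE_nat add_Suc)
  then show ?thesis
  proof cases
    case 3
    have "q_fact q (Suc k) \<noteq> 0" "q_fact q (Suc m) \<noteq> 0" "q_fact q k \<noteq> 0" "q_fact q m \<noteq> 0"
      using assms by simp_all
    then show ?thesis
      using assms unfolding 3
      by (simp add: gauss_binomial_q_fact q_fact_Suc divide_simps Suc_diff_le del: power_Suc)
        (simp add: algebra_simps power_add)
  qed (use assms in \<open>simp_all add: gauss_binomial_eq_0\<close>)
qed

lemma gauss_binomial_Suc':
  assumes "q > 1"
  shows "gauss_binomial q (Suc n) k =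
    (if k = 0 then 0 else gauss_binomial q n (k - 1)) + q ^ k * gauss_binomial q n k"
  using gauss_binomial_Suc[OF assms, of n "k - 1"] by (cases k) simp_all

text \<open>Induction on \<open>t\<close>: Pascal's rule splits the factor with \<open>t\<close>, an
  index shift aligns the exponents, and Pascal's rule in \<open>m\<close> merges the two sums again.
  This raises \<open>m\<close> and \<open>i\<close> by one, so both must vary.\<close>

lemma gauss_binomial_vandermonde:
  assumes "q > 1"
  shows "(\<Sum>j\<le>t. gauss_binomial q t j * gauss_binomial q m (j + i) * q ^ (j * (j + i))) =
    gauss_binomial q (m + t) (t + i)"
proof (induction t arbitrary: m i)
  case (Suc t)
  let ?g = "gauss_binomial q"
  have "(\<Sum>j\<le>Suc t. ?g (Suc t) j * ?g m (j + i) * q ^ (j * (j + i)))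
     = (\<Sum>j\<le>Suc t. (if j = 0 then 0 else ?g t (j - 1)) * ?g m (j + i) * q ^ (j * (j + i)))
     + (\<Sum>j\<le>Suc t. q ^ j * ?g t j * ?g m (j + i) * q ^ (j * (j + i)))"
    by (subst sum.distrib[symmetric], rule sum.cong[OF refl])
      (simp add: gauss_binomial_Suc'[OF assms, of t] algebra_simps)
  also have "(\<Sum>j\<le>Suc t. (if j = 0 then 0 else ?g t (j - 1)) * ?g m (j + i) * q ^ (j * (j + i)))
     = (\<Sum>j\<le>t. ?g t j * ?g m (Suc j + i) * q ^ (Suc j * (Suc j + i)))"
    by (subst sum.atMost_Suc_shift) simp
  also have "(\<Sum>j\<le>Suc t. q ^ j * ?g t j * ?g m (j + i) * q ^ (j * (j + i)))
     = (\<Sum>j\<le>t. q ^ j * ?g t j * ?g m (j + i) * q ^ (j * (j + i)))"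
    by (simp add: gauss_binomial_eq_0)
  also have "(\<Sum>j\<le>t. ?g t j * ?g m (Suc j + i) * q ^ (Suc j * (Suc j + i))) + \<dots>
     = (\<Sum>j\<le>t. ?g t j * ?g (Suc m) (j + Suc i) * q ^ (j * (j + Suc i)))"
    by (subst sum.distrib[symmetric], rule sum.cong[OF refl])
      (simp add: gauss_binomial_Suc[OF assms, of m] algebra_simps power_add)
  also have "\<dots> = ?g (m + Suc t) (Suc t + i)"
    using Suc.IH[of "Suc m" "Suc i"] by simp
  finally show ?case .
qed simp

section \<open>Type probabilities, their moments and chain weights\<close>

text \<open>The probability that a random \<open>a\<close>-dimensional subspace of \<open>L\<close>, if \<open>dim L = n\<close>, has type \<open>(a, k)\<close>.\<close>

definition type_prob :: "real \<Rightarrow> nat \<Rightarrow> nat \<Rightarrow> nat \<Rightarrow> real" where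
  "type_prob q n a k =
     gauss_binomial q (n - a - 1) (a - k - 1) * gauss_binomial q a k * q ^ ((a - k) * (a - k - 1)) /
     gauss_binomial q (n - 1) (a - 1)"

text \<open>The expected value of \<open>gauss_binomial q k b\<close>, the number of
  \<open>b\<close>-dimensional subspaces of \<open>D W\<close>, when \<open>W\<close> has type
  \<open>(a, k)\<close> with probability \<open>type_prob q n a k\<close>.\<close>

definition type_moment :: "real \<Rightarrow> nat \<Rightarrow> nat \<Rightarrow> nat \<Rightarrow> real" where
  "type_moment q n a b = gauss_binomial q a b * gauss_binomial q (n - b - 1) (a - b - 1) /
     gauss_binomial q (n - 1) (a - 1)"

text \<open>With \<open>j = a - k - 1\<close>, the flag identity pulls out
  \<open>gauss_binomial q a b\<close>, and what remains is the q-Vandermonde sum with shift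
  1.\<close>

lemma type_moment:
  assumes q: "q > 1" and "b < a" "a < n"
  shows "(\<Sum>k<a. type_prob q n a k * gauss_binomial q k b) = type_moment q n a b"
proof -
  let ?g = "gauss_binomial q"
  obtain t where t: "a = b + Suc t" using \<open>b < a\<close> less_imp_Suc_add by auto
  obtain m where m: "n = a + Suc m" using \<open>a < n\<close> less_imp_Suc_add by auto
  have "(\<Sum>k<a. ?g (n - a - 1) (a - k - 1) * ?g a k * q ^ ((a - k) * (a - k - 1)) * ?g k b)
    = (\<Sum>j<a. ?g m j * ?g a (a - Suc j) * q ^ (Suc j * j) * ?g (a - Suc j) b)"
    by (rule sum.reindex_bij_witness[of _ "\<lambda>j. a - Suc j" "\<lambda>k. a - Suc k"]) (auto simp: m Suc_diff_Suc)
  also have "\<dots> = (\<Sum>j<a. ?g a b * (?g m j * ?g (Suc t) (j + 1) * q ^ (j * (j + 1))))"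
  proof (rule sum.cong[OF refl])
    fix j assume j: "j \<in> {..<a}"
    show "?g m j * ?g a (a - Suc j) * q ^ (Suc j * j) * ?g (a - Suc j) b
      = ?g a b * (?g m j * ?g (Suc t) (j + 1) * q ^ (j * (j + 1)))"
    proof (cases "j \<le> t")
      case True
      have "?g a (a - Suc j) * ?g (a - Suc j) b = ?g a b * ?g (a - b) (a - Suc j - b)"
        using True by (intro gauss_binomial_subset q) (auto simp: t)
      also have "?g (a - b) (a - Suc j - b) = ?g (Suc t) (Suc j)"
        using True gauss_binomial_symmetric[OF q, of "Suc j" "Suc t"] by (simp add: t)
      finally show ?thesis by (simp add: mult_ac)
    next
      case False
      then have "a - Suc j < b" "Suc t < j + 1" using j by (auto simp: t)
      then show ?thesis by (simp add: gauss_binomial_eq_0)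
    qed
  qed
  also have "\<dots> = ?g a b * (\<Sum>j<a. ?g m j * ?g (Suc t) (j + 1) * q ^ (j * (j + 1)))"
    by (simp add: sum_distrib_left)
  \<comment> \<open>The range is enlarged and then cut to \<open>j \<le> m\<close>: terms with
    \<open>j > t\<close> vanish through the second factor, those with \<open>j > m\<close> through
    the first.\<close>
  also have "(\<Sum>j<a. ?g m j * ?g (Suc t) (j + 1) * q ^ (j * (j + 1))) =
    (\<Sum>j\<le>m + a. ?g m j * ?g (Suc t) (j + 1) * q ^ (j * (j + 1)))"
    by (rule sum.mono_neutral_left) (auto simp: t gauss_binomial_eq_0)
  also have "\<dots> = (\<Sum>j\<le>m. ?g m j * ?g (Suc t) (j + 1) * q ^ (j * (j + 1)))"
    by (rule sum.mono_neutral_right) (auto simp: gauss_binomial_eq_0)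
  also have "\<dots> = ?g (Suc t + m) (m + 1)"
    by (rule gauss_binomial_vandermonde[OF q])
  also have "\<dots> = ?g (n - b - 1) (a - b - 1)"
    by (subst gauss_binomial_symmetric[OF q]) (auto simp: t m)
  finally show ?thesis
    by (simp add: type_prob_def type_moment_def sum_divide_distrib[symmetric])
qed

lemma type_moment_0 [simp]: "q > 1 \<Longrightarrow> 0 < a \<Longrightarrow> a \<le> n \<Longrightarrow> type_moment q n a 0 = 1"
  by (simp add: type_moment_def gauss_binomial_nonzero)

lemma sum_type_prob: "q > 1 \<Longrightarrow> 0 < a \<Longrightarrow> a < n \<Longrightarrow> (\<Sum>k<a. type_prob q n a k) = 1"
  using type_moment[of q 0 a n] by simp

text \<open>For \<open>W\<close> the whole space \<open>D W = W\<close>, so all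
  \<open>b\<close>-dimensional subspaces are counted.\<close>

lemma type_moment_self: "q > 1 \<Longrightarrow> type_moment q n n b = gauss_binomial q n b"
  by (simp add: type_moment_def)

text \<open>\<open>2 * b - j\<close> is the dimension of \<open>Y + \<sigma> Y\<close> for \<open>Y\<close> of type \<open>(b, j)\<close>.\<close>

lemma type_moment_transfer:
  assumes q: "q > 1" and "j < b" "b < a" "a \<le> d" "d \<le> n"
  shows "gauss_binomial q d a * type_moment q n a b * type_prob q a b j =
    (if 2 * b - j \<le> a then gauss_binomial q (d - (2 * b - j)) (a - (2 * b - j)) else 0) *
    (type_moment q n d b * type_prob q d b j)"
proof (cases "2 * b - j \<le> a")
  case True
  \<comment> \<open>Natural-number differences become free summands, after which the identity is a
    cancellation of values of \<open>q_fact\<close>.\<close>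
  obtain s where s: "b = j + Suc s" using \<open>j < b\<close> less_imp_Suc_add by auto
  obtain t where t: "a = j + 2 * Suc s + t" using True \<open>j < b\<close> le_Suc_ex[OF True] by (auto simp: s)
  obtain x where x: "d = a + x" using \<open>a \<le> d\<close> le_Suc_ex by blast
  obtain y where y: "n = d + y" using \<open>d \<le> n\<close> le_Suc_ex by blast
  have nz: "q_fact q k \<noteq> 0" for k using q by simp
  show ?thesis
    using True nz
    by (simp add: type_moment_def type_prob_def gauss_binomial_q_fact[OF q] s t x y divide_simps
        del: q_fact_nonzero)
next
  case False
  then have "gauss_binomial q (a - b - 1) (b - j - 1) = 0"
    using assms by (intro gauss_binomial_eq_0) auto
  then show ?thesis using False by (simp add: type_prob_def)
qed


text \<open>The expected number of prolongations, by the given types, of a chain ending in some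
  \<open>Z\<close> of type \<open>(n, d)\<close>: choose \<open>W\<close> in the
  \<open>d\<close>-dimensional \<open>D Z\<close>, multiply by the probability of its type, and go
  on from \<open>W\<close>.\<close>

fun chain_weight :: "real \<Rightarrow> nat \<Rightarrow> nat \<Rightarrow> (nat \<times> nat) list \<Rightarrow> real" where
  "chain_weight q n d [] = 1"
| "chain_weight q n d ((a, b) # ts) = gauss_binomial q d a * type_prob q n a b * chain_weight q a b ts"

text \<open>The number of \<open>a\<close>-dimensional subspaces between \<open>Y + \<sigma> Y\<close> and a \<open>d\<close>-dimensional space,
  where \<open>Y\<close> has the first type in the list, or \<open>Y = 0\<close> if the list is empty.\<close>

fun between_count :: "real \<Rightarrow> nat \<Rightarrow> nat \<Rightarrow> (nat \<times> nat) list \<Rightarrow> real" where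
  "between_count q d a [] = gauss_binomial q d a"
| "between_count q d a ((b, j) # ts) =
    (if 2 * b - j \<le> a then gauss_binomial q (d - (2 * b - j)) (a - (2 * b - j)) else 0)"

definition proper_types :: "(nat \<times> nat) list \<Rightarrow> bool" where
  "proper_types ts \<longleftrightarrow> (\<forall>(a, b) \<in> set ts. b < a)"

lemma proper_types_simps [simp]:
  "proper_types []" "proper_types ((a, b) # ts) \<longleftrightarrow> b < a \<and> proper_types ts"
  by (auto simp: proper_types_def)

lemma between_count_self: "q > 1 \<Longrightarrow> a \<le> d \<Longrightarrow> between_count q d a ts \<noteq> 0 \<Longrightarrow> between_count q d d ts = 1"
  by (cases "(q, d, a, ts)" rule: between_count.cases) (auto split: if_splits)

text \<open>On the right \<open>a\<close> occurs only in \<open>between_count\<close>. Summing over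
  \<open>k\<close> produces a moment, and \<open>type_moment_transfer\<close> trades its dimension
  \<open>a\<close> for \<open>d\<close>.\<close>

lemma sum_chain_weight:
  assumes q: "q > 1" and "0 < a" "a < n" "a \<le> d" "d \<le> n" "proper_types ts"
  shows "(\<Sum>k<a. chain_weight q n d ((a, k) # ts)) =
    between_count q d a ts *
    (case ts of [] \<Rightarrow> 1 | (b, j) # ts' \<Rightarrow> type_moment q n d b * type_prob q d b j * chain_weight q b j ts')"
proof (cases ts)
  case Nil
  then show ?thesis using assms
    by (simp add: sum_distrib_left[symmetric] sum_type_prob)
next
  case (Cons t ts')
  obtain b j where t: "t = (b, j)" by fastforce
  let ?g = "gauss_binomial q"
  have "(\<Sum>k<a. chain_weight q n d ((a, k) # ts)) =
      (\<Sum>k<a. ?g d a * (type_prob q n a k * ?g k b) * (type_prob q a b j * chain_weight q b j ts'))"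
    by (simp add: Cons t mult_ac)
  also have "\<dots> = ?g d a * (\<Sum>k<a. type_prob q n a k * ?g k b) * type_prob q a b j * chain_weight q b j ts'"
    by (simp add: sum_distrib_left sum_distrib_right mult_ac)
  finally have eq: "(\<Sum>k<a. chain_weight q n d ((a, k) # ts)) = \<dots>" .
  show ?thesis
  proof (cases "b < a")
    case True
    then show ?thesis
      using type_moment_transfer[of q j b a d n] type_moment[of q b a n] assms
      unfolding eq by (simp add: Cons t)
  next
    case False
    then have "(\<Sum>k<a. type_prob q n a k * ?g k b) = 0"
      by (intro sum.neutral) (auto simp: gauss_binomial_eq_0)
    moreover have "\<not> 2 * b - j \<le> a" using False assms(6) by (auto simp: Cons t)
    ultimately show ?thesis unfolding eq by (simp add: Cons t)
  qed
qed

text \<open>The sums for \<open>a\<close> and for \<open>d\<close> share their second factor; the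
  first factor for \<open>d\<close> is 1 unless the one for \<open>a\<close> vanishes.\<close>

lemma sum_chain_weight_saturated:
  assumes "q > 1" and "0 < a" "a \<le> d" "d < n" "proper_types ts"
  shows "(\<Sum>k<a. chain_weight q n d ((a, k) # ts)) =
    between_count q d a ts * (\<Sum>e<d. chain_weight q n d ((d, e) # ts))"
  using assms sum_chain_weight[of q a n d ts] sum_chain_weight[of q d n d ts]
    between_count_self[of q a d ts] by fastforce

text \<open>For \<open>d = n\<close> the second factor is itself a chain weight, because the moment
  is then a full Gaussian binomial.\<close>

lemma sum_chain_weight_top:
  assumes "q > 1" and "0 < a" "a < n" "proper_types ts"
  shows "(\<Sum>k<a. chain_weight q n n ((a, k) # ts)) =
    between_count q n a ts * chain_weight q n n ts"
  using assms sum_chain_weight[of q a n n ts]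
  by (auto simp: type_moment_self split: list.splits prod.splits)

lemma gauss_binomial_quotient:
  assumes "q > 1" "0 < k" "k \<le> n"
  shows "gauss_binomial q n k / gauss_binomial q (n - 1) (k - 1) = gauss_binomial q n 1 / gauss_binomial q k 1"
proof -
  have "q ^ k - 1 \<noteq> 0" using one_less_power[OF assms(1,2)] by simp
  moreover have "gauss_binomial q (n - 1) (k - 1) \<noteq> 0"
    using assms by (intro gauss_binomial_nonzero) auto
  moreover have "gauss_binomial q m 1 = (q ^ m - 1) / (q - 1)" if "0 < m" for m
    using that assms(1) by (simp add: gauss_binomial_def divide_simps) (simp add: algebra_simps)
  ultimately show ?thesis
    using gauss_binomial_absorb[OF assms(1,2), of n] assms by (simp add: frac_eq_eq mult.commute)
qed

lemma chain_weight_upt: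
  "i \<le> r \<Longrightarrow> chain_weight q (a i) (b i) (map (\<lambda>j. (a j, b j)) [Suc i..<Suc r]) =
    (\<Prod>j = i..<r. gauss_binomial q (b j) (a (Suc j)) * type_prob q (a j) (a (Suc j)) (b (Suc j)))"
proof (induction i rule: inc_induct)
  case (step i)
  then show ?case
    by (subst upt_conv_Cons) (simp_all add: prod.atLeast_Suc_lessThan[of i r] del: upt_Suc)
qed simp

lemma chain_weight_closed_form:
  fixes a1 a2 :: "nat \<Rightarrow> nat"
  assumes q: "q > 1" and "a1 0 = N" "a2 0 = N" "0 < a1 1" "a1 1 \<le> N" "r \<ge> 1" "a1 (r + 1) = 0"
  shows "chain_weight q N N (map (\<lambda>i. (a1 i, a2 i)) [1..<r + 1]) =
    gauss_binomial q N 1 / gauss_binomial q (a1 1) 1 *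
    ((\<Prod>i = 0..r - 1.
        gauss_binomial q (a1 i - a1 (i + 1) - 1) (a1 (i + 1) - a2 (i + 1) - 1) *
        gauss_binomial q (a1 (i + 1)) (a2 (i + 1)) *
        gauss_binomial q (a2 (i + 1)) (a1 (i + 2))) /
     (\<Prod>i = 1..r - 1. gauss_binomial q (a1 i - 1) (a1 (i + 1) - 1))) *
    q ^ (\<Sum>i = 1..r. (a1 i - a2 i) * (a1 i - a2 i - 1))"
proof -
  let ?g = "gauss_binomial q"
  obtain s where s: "r = Suc s" using \<open>r \<ge> 1\<close> by (cases r) auto
  define F where "F = (\<Prod>i<r. ?g (a1 i - a1 (Suc i) - 1) (a1 (Suc i) - a2 (Suc i) - 1) *
    ?g (a1 (Suc i)) (a2 (Suc i)))"
  define G where "G = (\<Prod>i<r. ?g (a2 (Suc i)) (a1 (Suc (Suc i))))"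
  define H where "H = (\<Prod>i<s. ?g (a1 (Suc i) - 1) (a1 (Suc (Suc i)) - 1))"
  define E where "E = (\<Sum>i<r. (a1 (Suc i) - a2 (Suc i)) * (a1 (Suc i) - a2 (Suc i) - 1))"
  have "chain_weight q N N (map (\<lambda>i. (a1 i, a2 i)) [1..<r + 1]) =
      (\<Prod>j<r. ?g (a2 j) (a1 (Suc j)) * type_prob q (a1 j) (a1 (Suc j)) (a2 (Suc j)))"
    using chain_weight_upt[of 0 r q a1 a2] assms by (simp add: atLeast0LessThan del: upt_Suc)
  also have "\<dots> = (\<Prod>j<r. ?g (a2 j) (a1 (Suc j))) * (F * q ^ E) / (\<Prod>j<r. ?g (a1 j - 1) (a1 (Suc j) - 1))"
    by (simp add: type_prob_def F_def E_def prod.distrib prod_dividef power_sum)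
  \<comment> \<open>The factor \<open>j = 0\<close> splits off, and the additional last factor of
    \<open>G\<close> is 1 because \<open>a1 (r + 1) = 0\<close>.\<close>
  also have "(\<Prod>j<r. ?g (a2 j) (a1 (Suc j))) = ?g N (a1 1) * G"
  proof -
    have "G = (\<Prod>i<s. ?g (a2 (Suc i)) (a1 (Suc (Suc i))))" using assms(7) by (simp add: G_def s)
    then show ?thesis
      using assms(3) by (simp add: s prod.lessThan_Suc_shift del: prod.lessThan_Suc)
  qed
  also have "(\<Prod>j<r. ?g (a1 j - 1) (a1 (Suc j) - 1)) = ?g (N - 1) (a1 1 - 1) * H"
    using assms by (simp add: s H_def prod.lessThan_Suc_shift del: prod.lessThan_Suc)
  also have "?g N (a1 1) * G * (F * q ^ E) / (?g (N - 1) (a1 1 - 1) * H) =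
      ?g N (a1 1) / ?g (N - 1) (a1 1 - 1) * ((F * G) / H) * q ^ E"
    by (simp add: mult_ac)
  also have "?g N (a1 1) / ?g (N - 1) (a1 1 - 1) = ?g N 1 / ?g (a1 1) 1"
    using assms by (intro gauss_binomial_quotient)
  also have "F * G = (\<Prod>i = 0..r - 1.
        ?g (a1 i - a1 (i + 1) - 1) (a1 (i + 1) - a2 (i + 1) - 1) *
        ?g (a1 (i + 1)) (a2 (i + 1)) * ?g (a2 (i + 1)) (a1 (i + 2)))"
    by (simp add: F_def G_def s prod.distrib atLeast0AtMost lessThan_Suc_atMost del: prod.lessThan_Suc)
  also have "H = (\<Prod>i = 1..r - 1. ?g (a1 i - 1) (a1 (i + 1) - 1))"
    by (simp add: H_def s prod.atLeast1_atMost_eq)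
  also have "E = (\<Sum>i = 1..r. (a1 i - a2 i) * (a1 i - a2 i - 1))"
    by (simp only: E_def One_nat_def sum.atLeast1_atMost_eq)
  finally show ?thesis .
qed

section \<open>Counting chains in a lattice of subspaces\<close>

text \<open>\<open>D W\<close> models \<open>W \<inter> \<sigma>\<inverse> W\<close> and
  \<open>U W\<close> models \<open>W + \<sigma> W\<close>, an adjoint pair for inclusion;
  \<open>dim_D\<close> expresses that no proper nonzero subspace is invariant.\<close>

locale simple_operator_lattice =
  fixes S :: "'a set set" and dim :: "'a set \<Rightarrow> nat" and D U :: "'a set \<Rightarrow> 'a set"
    and V :: "'a set" and N :: nat and q :: real
  assumes q: "q > 1" and finite_S: "finite S"
    and V_in: "V \<in> S" and dim_V: "dim V = N" and D_V: "D V = V"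
    and D_in: "W \<in> S \<Longrightarrow> D W \<in> S" and U_in: "W \<in> S \<Longrightarrow> U W \<in> S"
    and galois: "W \<in> S \<Longrightarrow> Y \<in> S \<Longrightarrow> U Y \<subseteq> W \<longleftrightarrow> Y \<subseteq> D W"
    and dim_U: "W \<in> S \<Longrightarrow> dim (U W) = 2 * dim W - dim (D W)"
    and dim_mono: "W \<in> S \<Longrightarrow> Y \<in> S \<Longrightarrow> W \<subseteq> Y \<Longrightarrow> dim W \<le> dim Y"
    and dim_D: "W \<in> S \<Longrightarrow> 0 < dim W \<Longrightarrow> dim W < N \<Longrightarrow> dim (D W) < dim W"
    and card_below: "W \<in> S \<Longrightarrow> card {Z \<in> S. Z \<subseteq> W \<and> dim Z = a} = gauss_binomial q (dim W) a"
    and card_between: "W \<in> S \<Longrightarrow> Y \<in> S \<Longrightarrow> Y \<subseteq> W \<Longrightarrow> dim Y \<le> a \<Longrightarrow>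
      card {Z \<in> S. Y \<subseteq> Z \<and> Z \<subseteq> W \<and> dim Z = a} = gauss_binomial q (dim W - dim Y) (a - dim Y)"
begin

fun num :: "'a set \<Rightarrow> (nat \<times> nat) list \<Rightarrow> real" where
  "num Z [] = 1"
| "num Z ((a, b) # ts) = (\<Sum>W | W \<in> S \<and> W \<subseteq> D Z \<and> dim W = a \<and> dim (D W) = b. num W ts)"

text \<open>Double counting of pairs of \<open>W\<close> and the next member \<open>Y\<close>: by
  adjointness \<open>W\<close> runs through the spaces between \<open>U Y\<close> and
  \<open>T\<close>, and their number depends only on dimensions.\<close>

lemma sum_num_below:
  assumes T: "T \<in> S" and a: "a \<le> dim T"
  shows "(\<Sum>W | W \<in> S \<and> W \<subseteq> T \<and> dim W = a. num W ts) = between_count q (dim T) a ts * num T ts"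
proof (cases ts)
  case Nil
  then show ?thesis using card_below[OF T] by simp
next
  case (Cons t ts')
  obtain b j where t: "t = (b, j)" by fastforce
  let ?Y = "{Y \<in> S. dim Y = b \<and> dim (D Y) = j}"
  have fin: "finite {W \<in> S. P W}" for P using finite_S by simp
  have "(\<Sum>W | W \<in> S \<and> W \<subseteq> T \<and> dim W = a. num W ts) =
      (\<Sum>W | W \<in> S \<and> W \<subseteq> T \<and> dim W = a. \<Sum>Y | Y \<in> ?Y \<and> Y \<subseteq> D W. num Y ts')"
    unfolding Cons t num.simps by (intro sum.cong refl) auto
  also have "\<dots> = (\<Sum>Y\<in>?Y. \<Sum>W | W \<in> {W \<in> S. W \<subseteq> T \<and> dim W = a} \<and> Y \<subseteq> D W. num Y ts')"
    by (subst sum.swap_restrict[OF fin fin, symmetric]) simp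
  also have "\<dots> = (\<Sum>Y\<in>?Y. card {W \<in> S. U Y \<subseteq> W \<and> W \<subseteq> T \<and> dim W = a} * num Y ts')"
  proof (rule sum.cong[OF refl])
    fix Y assume "Y \<in> ?Y"
    then have "{W. W \<in> {W \<in> S. W \<subseteq> T \<and> dim W = a} \<and> Y \<subseteq> D W} =
        {W \<in> S. U Y \<subseteq> W \<and> W \<subseteq> T \<and> dim W = a}"
      using galois by auto
    then show "(\<Sum>W | W \<in> {W \<in> S. W \<subseteq> T \<and> dim W = a} \<and> Y \<subseteq> D W. num Y ts') =
        card {W \<in> S. U Y \<subseteq> W \<and> W \<subseteq> T \<and> dim W = a} * num Y ts'"
      by simp
  qed
  also have "\<dots> = (\<Sum>Y\<in>?Y. if Y \<subseteq> D T then between_count q (dim T) a ts * num Y ts' else 0)"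
  proof (rule sum.cong[OF refl])
    fix Y assume Y: "Y \<in> ?Y"
    then have dU: "dim (U Y) = 2 * b - j" using dim_U by auto
    show "card {W \<in> S. U Y \<subseteq> W \<and> W \<subseteq> T \<and> dim W = a} * num Y ts' =
        (if Y \<subseteq> D T then between_count q (dim T) a ts * num Y ts' else 0)"
    proof (cases "Y \<subseteq> D T")
      case True
      then have UT: "U Y \<subseteq> T" using galois T Y by auto
      show ?thesis
      proof (cases "2 * b - j \<le> a")
        case True
        then show ?thesis
          using card_between[OF T U_in UT, of a] Y dU \<open>Y \<subseteq> D T\<close> by (simp add: Cons t)
      next
        case False
        then have empty: "{W \<in> S. U Y \<subseteq> W \<and> W \<subseteq> T \<and> dim W = a} = {}"
          using dim_mono[OF U_in, of Y] Y dU by fastforce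
        show ?thesis unfolding empty using False by (simp add: Cons t)
      qed
    next
      case False
      then have empty: "{W \<in> S. U Y \<subseteq> W \<and> W \<subseteq> T \<and> dim W = a} = {}"
        using galois T Y by auto
      show ?thesis unfolding empty using False by simp
    qed
  qed
  also have "\<dots> = (\<Sum>Y | Y \<in> ?Y \<and> Y \<subseteq> D T. between_count q (dim T) a ts * num Y ts')"
    by (rule sum.inter_filter[OF fin, symmetric])
  also have "\<dots> = between_count q (dim T) a ts * (\<Sum>Y | Y \<in> ?Y \<and> Y \<subseteq> D T. num Y ts')"
    by (simp add: sum_distrib_left)
  also have "(\<Sum>Y | Y \<in> ?Y \<and> Y \<subseteq> D T. num Y ts') = num T ts"
    unfolding Cons t num.simps by (intro sum.cong refl) auto
  finally show ?thesis .
qed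

text \<open>By \<open>dim_D\<close> every \<open>W\<close> of dimension \<open>a\<close> has some
  type \<open>(a, k)\<close> with \<open>k < a\<close>, so the sum over \<open>k\<close> drops the
  condition on \<open>D W\<close>, and \<open>sum_num_below\<close> applies with
  \<open>T = D Z\<close>.\<close>

lemma sum_num_types:
  assumes Z: "Z \<in> S" and "0 < a" "a < N" "a \<le> dim (D Z)"
  shows "(\<Sum>k<a. num Z ((a, k) # ts)) = between_count q (dim (D Z)) a ts * num (D Z) ts"
proof -
  let ?W = "{W \<in> S. W \<subseteq> D Z \<and> dim W = a}"
  have "(\<Sum>k<a. num Z ((a, k) # ts)) = (\<Sum>k<a. \<Sum>W | W \<in> ?W \<and> dim (D W) = k. num W ts)"
    by (intro sum.cong refl) (simp add: conj_ac)
  also have "\<dots> = (\<Sum>W\<in>?W. num W ts)"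
    using finite_S assms(2,3) dim_D by (intro sum.group) auto
  also have "\<dots> = between_count q (dim (D Z)) a ts * num (D Z) ts"
    using sum_num_below[OF D_in[OF Z]] assms(4) by simp
  finally show ?thesis .
qed

lemma num_eq_0:
  assumes "Z \<in> S" "dim (D Z) < a"
  shows "num Z ((a, b) # ts) = 0"
proof -
  have "{W. W \<in> S \<and> W \<subseteq> D Z \<and> dim W = a \<and> dim (D W) = b} = {}"
    using assms dim_mono[OF _ D_in, of _ Z] by fastforce
  then show ?thesis by (simp only: num.simps sum.empty)
qed

section \<open>Weighted chain counts and their determination\<close>

text \<open>A weight \<open>\<mu>\<close> on subspaces stands for the distribution of the last member of a chain with
  prescribed types; \<open>wnum \<mu> ts\<close> counts the prolongations of such chains by the types \<open>ts\<close>.\<close>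

definition wnum :: "('a set \<Rightarrow> real) \<Rightarrow> (nat \<times> nat) list \<Rightarrow> real" where
  "wnum \<mu> ts = (\<Sum>Z\<in>S. \<mu> Z * num Z ts)"

definition weight_on :: "nat \<Rightarrow> nat \<Rightarrow> ('a set \<Rightarrow> real) \<Rightarrow> bool" where
  "weight_on n d \<mu> \<longleftrightarrow> (\<forall>Z\<in>S. \<mu> Z \<noteq> 0 \<longrightarrow> dim Z = n \<and> dim (D Z) = d)"

text \<open>The weight carried over to the next member: \<open>W\<close> collects the weights of all
  its possible predecessors.\<close>

definition extend :: "('a set \<Rightarrow> real) \<Rightarrow> nat \<Rightarrow> nat \<Rightarrow> 'a set \<Rightarrow> real" where
  "extend \<mu> a k W = (if dim W = a \<and> dim (D W) = k then \<Sum>Z | Z \<in> S \<and> W \<subseteq> D Z. \<mu> Z else 0)"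

lemma weight_on_extend: "weight_on a k (extend \<mu> a k)"
  by (auto simp: weight_on_def extend_def)

lemma wnum_extend: "wnum (extend \<mu> a k) ts = wnum \<mu> ((a, k) # ts)"
proof -
  let ?W = "{W \<in> S. dim W = a \<and> dim (D W) = k}"
  have "wnum (extend \<mu> a k) ts = (\<Sum>W\<in>S. if W \<in> ?W then (\<Sum>Z | Z \<in> S \<and> W \<subseteq> D Z. \<mu> Z * num W ts) else 0)"
    unfolding wnum_def by (intro sum.cong refl) (simp add: extend_def sum_distrib_right)
  also have "\<dots> = (\<Sum>W\<in>?W. \<Sum>Z | Z \<in> S \<and> W \<subseteq> D Z. \<mu> Z * num W ts)"
    using finite_S by (subst sum.inter_filter) (auto intro!: sum.cong)
  also have "\<dots> = (\<Sum>Z\<in>S. \<Sum>W | W \<in> ?W \<and> W \<subseteq> D Z. \<mu> Z * num W ts)"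
    using finite_S by (intro sum.swap_restrict) auto
  also have "\<dots> = wnum \<mu> ((a, k) # ts)"
    unfolding wnum_def num.simps sum_distrib_left by (intro sum.cong refl) auto
  finally show ?thesis .
qed

text \<open>As in \<open>sum_chain_weight\<close>, the last factor does not depend on
  \<open>a\<close>, so \<open>a\<close> can be compared with \<open>d\<close>.\<close>

lemma sum_wnum_types:
  assumes "weight_on n d \<mu>" and "0 < a" "a < N" "a \<le> d"
  shows "(\<Sum>k<a. wnum \<mu> ((a, k) # ts)) = between_count q d a ts * (\<Sum>Z\<in>S. \<mu> Z * num (D Z) ts)"
proof -
  have "(\<Sum>k<a. wnum \<mu> ((a, k) # ts)) = (\<Sum>Z\<in>S. \<mu> Z * (\<Sum>k<a. num Z ((a, k) # ts)))"
    unfolding wnum_def sum_distrib_left by (rule sum.swap)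
  also have "\<dots> = (\<Sum>Z\<in>S. between_count q d a ts * (\<mu> Z * num (D Z) ts))"
  proof (rule sum.cong[OF refl])
    fix Z assume Z: "Z \<in> S"
    show "\<mu> Z * (\<Sum>k<a. num Z ((a, k) # ts)) = between_count q d a ts * (\<mu> Z * num (D Z) ts)"
    proof (cases "\<mu> Z = 0")
      case False
      then have "dim (D Z) = d" using assms(1) Z by (auto simp: weight_on_def)
      then show ?thesis using sum_num_types[OF Z assms(2,3)] assms(4) by simp
    qed simp
  qed
  finally show ?thesis by (simp add: sum_distrib_left)
qed

lemma wnum_eq_0:
  assumes "weight_on n d \<mu>" "d < a"
  shows "wnum \<mu> ((a, b) # ts) = 0"
  unfolding wnum_def
proof (rule sum.neutral, rule ballI)
  fix Z assume "Z \<in> S"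
  then show "\<mu> Z * num Z ((a, b) # ts) = 0"
    using assms num_eq_0[of Z a b ts] by (cases "\<mu> Z = 0") (auto simp: weight_on_def)
qed

text \<open>\<open>wnum \<mu> []\<close> is the total mass, so this concerns the average number of
  prolongations, not the number for a single \<open>Z\<close>.\<close>

definition formula_on :: "nat \<Rightarrow> nat \<Rightarrow> ('a set \<Rightarrow> real) \<Rightarrow> (nat \<times> nat) list \<Rightarrow> bool" where
  "formula_on n d \<mu> ts \<longleftrightarrow> wnum \<mu> ts = wnum \<mu> [] * chain_weight q n d ts"

text \<open>The chain \<open>W\<^sub>i, W\<^sub>i\<^sub>+\<^sub>1\<close> is saturated if \<open>W\<^sub>i\<^sub>+\<^sub>1 = D W\<^sub>i\<close>.  For a saturated tail, the sum over
  \<open>k\<close> involves, besides the unknown term, only terms with a larger \<open>k\<close>; terms with a smaller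
  \<open>k\<close> vanish.\<close>

lemma formula_on_extend:
  assumes \<mu>: "weight_on n d \<mu>" and a: "0 < a" "a < N" "a < n" "a \<le> d"
    and main: "\<And>ts. proper_types ts \<Longrightarrow> (\<Sum>k<a. wnum \<mu> ((a, k) # ts)) =
      wnum \<mu> [] * (\<Sum>k<a. chain_weight q n d ((a, k) # ts))"
    and step: "\<And>\<nu> k ts. k < a \<Longrightarrow> weight_on a k \<nu> \<Longrightarrow>
      (\<And>e ts. e < k \<Longrightarrow> proper_types ts \<Longrightarrow> formula_on a k \<nu> ((k, e) # ts)) \<Longrightarrow>
      proper_types ts \<Longrightarrow> formula_on a k \<nu> ts"
    and "k < a" "proper_types ts"
  shows "formula_on n d \<mu> ((a, k) # ts)"
  using \<open>k < a\<close> \<open>proper_types ts\<close>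
proof (induction "a - k" arbitrary: k ts rule: less_induct)
  case less
  \<comment> \<open>Saturated tails, together with the empty tail for \<open>k = 0\<close>: the
    linear relation \<open>main\<close> is solved for its \<open>k\<close>-th term.\<close>
  have sat: "formula_on n d \<mu> ((a, k) # ts')"
    if "proper_types ts'" "(k = 0 \<and> ts' = []) \<or> (\<exists>e ts''. ts' = (k, e) # ts'')" for ts'
  proof -
    have other: "wnum \<mu> ((a, k') # ts') = wnum \<mu> [] * chain_weight q n d ((a, k') # ts')"
      if "k' \<in> {..<a} - {k}" for k'
    proof (cases "k < k'")
      case True
      then show ?thesis
        using less.hyps[of k' ts'] that \<open>k < a\<close> \<open>proper_types ts'\<close> by (simp add: formula_on_def)
    next
      case False
      then have "k' < k" using that by auto
      then obtain e ts'' where ts': "ts' = (k, e) # ts''"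
        using \<open>(k = 0 \<and> ts' = []) \<or> _\<close> by auto
      \<comment> \<open>A \<open>k\<close>-dimensional member does not fit into \<open>D W\<close>
        of dimension \<open>k' < k\<close>.\<close>
      have "wnum \<mu> ((a, k') # ts') = 0"
        using wnum_eq_0[OF weight_on_extend[of a k' \<mu>] \<open>k' < k\<close>, of e ts''] by (simp add: wnum_extend ts')
      then show ?thesis using \<open>k' < k\<close> by (simp add: ts' gauss_binomial_eq_0)
    qed
    have "wnum \<mu> ((a, k) # ts') + (\<Sum>k'\<in>{..<a} - {k}. wnum \<mu> ((a, k') # ts')) =
        wnum \<mu> [] * chain_weight q n d ((a, k) # ts') +
        (\<Sum>k'\<in>{..<a} - {k}. wnum \<mu> [] * chain_weight q n d ((a, k') # ts'))"
      using main[OF \<open>proper_types ts'\<close>] \<open>k < a\<close>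
      by (simp add: sum.remove[of "{..<a}" k] sum_distrib_left distrib_left)
    then show ?thesis using other by (simp add: formula_on_def)
  qed
  let ?\<nu> = "extend \<mu> a k"
  \<comment> \<open>For \<open>k > 0\<close> every \<open>W\<close> has exactly one saturated
    prolongation, by \<open>D W\<close>, so the mass of the new weight is the sum over
    \<open>e\<close> of counts known from \<open>sat\<close>.\<close>
  have total: "wnum ?\<nu> [] = wnum \<mu> [] * chain_weight q n d [(a, k)]"
  proof (cases "k = 0")
    case True
    then show ?thesis using sat[of "[]"] by (simp add: formula_on_def wnum_extend)
  next
    case False
    have "wnum ?\<nu> [] = (\<Sum>e<k. wnum ?\<nu> [(k, e)])"
      using sum_wnum_types[OF weight_on_extend[of a k \<mu>], of k "[]"] False a \<open>k < a\<close> q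
      by (simp add: wnum_def)
    also have "\<dots> = (\<Sum>e<k. wnum \<mu> [] * chain_weight q n d [(a, k), (k, e)])"
      using sat by (intro sum.cong refl) (auto simp: formula_on_def wnum_extend)
    also have "\<dots> = wnum \<mu> [] * chain_weight q n d [(a, k)] * (\<Sum>e<k. type_prob q a k e)"
      using q by (simp add: sum_distrib_left mult_ac)
    finally show ?thesis
      using sum_type_prob[OF q, of k a] False \<open>k < a\<close> by simp
  qed
  \<comment> \<open>Given the mass, \<open>sat\<close> becomes the saturated case of the formula for
    \<open>?\<nu>\<close>, and \<open>step\<close> passes to arbitrary tails.\<close>
  have "formula_on a k ?\<nu> ts"
  proof (rule step[OF \<open>k < a\<close> weight_on_extend _ \<open>proper_types ts\<close>])
    fix e ts' assume "e < k" "proper_types ts'"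
    then have "formula_on n d \<mu> ((a, k) # (k, e) # ts')" by (intro sat) auto
    then show "formula_on a k ?\<nu> ((k, e) # ts')"
      using total by (simp add: formula_on_def wnum_extend)
  qed
  then show ?case using total by (simp add: formula_on_def wnum_extend)
qed

text \<open>Induction on \<open>d\<close>. If the first dimension \<open>a\<close> is below
  \<open>d\<close>, the sum over \<open>k\<close> is \<open>between_count\<close> times the
  saturated sum, for counts and weights alike; \<open>formula_on_extend\<close> separates the terms,
  using the induction hypothesis at \<open>k < d\<close>.\<close>

lemma formula_on_of_saturated:
  assumes "weight_on n d \<mu>" "d < n" "d < N"
    and "\<And>e ts. e < d \<Longrightarrow> proper_types ts \<Longrightarrow> formula_on n d \<mu> ((d, e) # ts)"
    and "proper_types ts"
  shows "formula_on n d \<mu> ts"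
  using assms
proof (induction d arbitrary: n \<mu> ts rule: less_induct)
  case (less d)
  show ?case
  proof (cases ts)
    case Nil
    then show ?thesis by (simp add: formula_on_def)
  next
    case (Cons t ts')
    obtain a b where t: "t = (a, b)" by fastforce
    have ab: "b < a" "proper_types ts'" using less.prems(5) by (auto simp: Cons t)
    consider "a < d" | "a = d" | "d < a" by linarith
    then show ?thesis
    proof cases
      case 1
      show ?thesis
        unfolding Cons t
      proof (rule formula_on_extend[OF less.prems(1) _ _ _ _ _ _ ab])
        fix us assume us: "proper_types us"
        let ?R = "\<Sum>Z\<in>S. \<mu> Z * num (D Z) us"
        have R: "(\<Sum>k<c. wnum \<mu> ((c, k) # us)) = between_count q d c us * ?R" if "0 < c" "c \<le> d" for c
          using sum_wnum_types[OF less.prems(1), of c us] that less.prems(3) by simp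
        have "(\<Sum>k<a. wnum \<mu> ((a, k) # us)) =
            between_count q d a us * (\<Sum>e<d. wnum \<mu> ((d, e) # us))"
          using R[of a] R[of d] between_count_self[OF q, of a d us] 1 ab(1)
          by (cases "between_count q d a us = 0") simp_all
        also have "(\<Sum>e<d. wnum \<mu> ((d, e) # us)) = wnum \<mu> [] * (\<Sum>e<d. chain_weight q n d ((d, e) # us))"
          unfolding sum_distrib_left
          using less.prems(4) us by (intro sum.cong refl) (simp add: formula_on_def)
        finally show "(\<Sum>k<a. wnum \<mu> ((a, k) # us)) =
            wnum \<mu> [] * (\<Sum>k<a. chain_weight q n d ((a, k) # us))"
          using sum_chain_weight_saturated[OF q, of a d n us] 1 ab(1) less.prems(2) us by (simp add: mult_ac)
      next
        fix \<nu> k us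
        assume "k < a" "weight_on a k \<nu>" "proper_types us"
          and "\<And>e vs. e < k \<Longrightarrow> proper_types vs \<Longrightarrow> formula_on a k \<nu> ((k, e) # vs)"
        then show "formula_on a k \<nu> us" using less.IH[of k a \<nu> us] 1 less.prems(3) by simp
      qed (use 1 ab less.prems in simp_all)
    next
      case 2
      then show ?thesis using less.prems(4) ab by (simp add: Cons t)
    next
      case 3
      then show ?thesis
        using wnum_eq_0[OF less.prems(1) 3] by (simp add: formula_on_def Cons t gauss_binomial_eq_0)
    qed
  qed
qed

theorem num_top:
  assumes "a < N" "proper_types ((a, k) # ts)"
  shows "num V ((a, k) # ts) = chain_weight q N N ((a, k) # ts)"
  using assms
proof (induction a arbitrary: k ts rule: less_induct)
  case (less a)
  let ?\<mu> = "\<lambda>Z. if Z = V then 1 else (0::real)"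
  have wnum: "wnum ?\<mu> us = num V us" for us
    using finite_S V_in by (simp add: wnum_def if_distrib[of "\<lambda>x. x * _"] cong: if_cong)
  have \<mu>: "weight_on N N ?\<mu>" by (simp add: weight_on_def dim_V D_V)
  have ka: "k < a" "proper_types ts" using less.prems by auto
  have "formula_on N N ?\<mu> ((a, k) # ts)"
  proof (rule formula_on_extend[OF \<mu> _ _ _ _ _ _ ka])
    fix us assume us: "proper_types us"
    have "(\<Sum>k<a. num V ((a, k) # us)) = between_count q N a us * num V us"
      using sum_num_types[OF V_in, of a us] ka(1) less.prems by (simp add: D_V dim_V)
    also have "\<dots> = between_count q N a us * chain_weight q N N us"
    proof (cases us)
      case (Cons u us')
      obtain b j where u: "u = (b, j)" by fastforce
      show ?thesis
      proof (cases "b < a")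
        case True
        then show ?thesis using less.IH[of b j us'] less.prems us by (simp add: Cons u)
      next
        case False
        then have "\<not> 2 * b - j \<le> a" using us by (auto simp: Cons u)
        then show ?thesis by (simp add: Cons u)
      qed
    qed simp
    finally show "(\<Sum>k<a. wnum ?\<mu> ((a, k) # us)) =
        wnum ?\<mu> [] * (\<Sum>k<a. chain_weight q N N ((a, k) # us))"
      using sum_chain_weight_top[OF q, of a N us] ka(1) less.prems(1) us by (simp add: wnum)
  next
    fix \<nu> k us
    assume "k < a" "weight_on a k \<nu>" "proper_types us"
      and "\<And>e vs. e < k \<Longrightarrow> proper_types vs \<Longrightarrow> formula_on a k \<nu> ((k, e) # vs)"
    then show "formula_on a k \<nu> us" using formula_on_of_saturated[of a k \<nu> us] less.prems(1) by simp
  qed (use ka less.prems in simp_all)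
  then show ?case by (simp add: formula_on_def wnum)
qed

section \<open>Chains as lists\<close>

fun chains :: "'a set \<Rightarrow> (nat \<times> nat) list \<Rightarrow> 'a set list set" where
  "chains Z [] = {[]}"
| "chains Z ((a, b) # ts) = (\<lambda>(W, Ws). W # Ws) `
     (SIGMA W : {W \<in> S. W \<subseteq> D Z \<and> dim W = a \<and> dim (D W) = b}. chains W ts)"

lemma finite_chains: "finite (chains Z ts)"
  by (induction Z ts rule: chains.induct) (use finite_S in auto)

lemma card_chains: "real (card (chains Z ts)) = num Z ts"
proof (induction Z ts rule: chains.induct)
  case (2 Z a b ts)
  have "card (chains Z ((a, b) # ts)) =
      card (SIGMA W : {W \<in> S. W \<subseteq> D Z \<and> dim W = a \<and> dim (D W) = b}. chains W ts)"
    unfolding chains.simps by (rule card_image) (auto simp: inj_on_def)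
  then show ?case using finite_S finite_chains 2 by simp
qed simp

text \<open>Prepending \<open>Z\<close> makes \<open>(Z # Ws) ! i\<close> the predecessor of
  \<open>Ws ! i\<close>, also for the first member.\<close>

lemma chains_iff:
  "Ws \<in> chains Z ts \<longleftrightarrow> length Ws = length ts \<and>
    (\<forall>i < length ts. Ws ! i \<in> S \<and> dim (Ws ! i) = fst (ts ! i) \<and> dim (D (Ws ! i)) = snd (ts ! i) \<and>
      Ws ! i \<subseteq> D ((Z # Ws) ! i))"
proof (induction Z ts arbitrary: Ws rule: chains.induct)
  case (2 Z a b ts)
  then show ?case by (cases Ws) (auto simp: All_less_Suc2)
qed simp

end

section \<open>Subspaces of a finite field extension\<close>

text \<open>Coordinates with respect to a basis. Dimensions can thus be compared by counting
  elements.\<close>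

lemma (in ring) card_dimension:
  assumes K: "subfield K R" "finite K" and E: "dimension n K E"
  shows "finite E" "card E = card K ^ n"
proof -
  obtain Us where Us: "set Us \<subseteq> carrier R" "independent K Us" "length Us = n" "Span K Us = E"
    using exists_base[OF K(1) E] by blast
  let ?L = "{Ks. set Ks \<subseteq> K \<and> length Ks = n}"
  have img: "(\<lambda>Ks. combine Ks Us) ` ?L = E"
    using Span_eq_combine_set_length_version[OF K(1) Us(1)] Us(3,4) by auto
  moreover have "inj_on (\<lambda>Ks. combine Ks Us) ?L"
  proof (rule inj_onI)
    fix Ks Ks' assume "Ks \<in> ?L" "Ks' \<in> ?L" and eq: "combine Ks Us = combine Ks' Us"
    then show "Ks = Ks'"
      using unique_decomposition[OF K(1) Us(2), of "combine Ks Us"] img Us(3,4) by auto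
  qed
  ultimately have "bij_betw (\<lambda>Ks. combine Ks Us) ?L E" by (simp add: bij_betw_def)
  then show "finite E" "card E = card K ^ n"
    using finite_lists_length_eq[OF K(2), of n] card_lists_length_eq[OF K(2), of n]
    by (simp_all flip: bij_betw_finite add: bij_betw_same_card[symmetric])
qed

locale finite_field_extension = field L for L :: "('a, 'b) ring_scheme" (structure) +
  fixes K :: "'a set"
  assumes subfield: "subfield K L" and finite_carrier: "finite (carrier L)"
begin

abbreviation "vsubspace W \<equiv> subalgebra K W L"
abbreviation "q \<equiv> card K"

lemma K_subset: "K \<subseteq> carrier L"
  using subfield by (rule subfieldE(3))

lemma finite_K: "finite K"
  using K_subset finite_carrier finite_subset by blast

lemma q_gt_1: "q > 1"
proof -
  have "{\<zero>, \<one>} \<subseteq> K" "\<zero> \<noteq> \<one>"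
    using subfieldE(1)[OF subfield] subringE(2,3) subfieldE(6)[OF subfield] by auto
  then show ?thesis
    using card_mono[OF finite_K, of "{\<zero>, \<one>}"] by simp
qed

lemma finite_subspaces: "finite {W. vsubspace W}"
  using finite_subset[of "{W. vsubspace W}" "Pow (carrier L)"] finite_carrier subalgebra_in_carrier
  by auto

lemma subspace_carrier: "vsubspace (carrier L)"
  using carrier_is_subalgebra[OF K_subset] .

lemma subspace_dimension:
  assumes "vsubspace W"
  shows "dimension (dim K W) K W"
proof -
  \<comment> \<open>The list of all elements spans, so every subspace has finite dimension.\<close>
  obtain Us where Us: "set Us = carrier L" using finite_list[OF finite_carrier] by blast
  have "carrier L \<subseteq> Span K Us" using Span_base_incl[OF subfield, of Us] Us by simp
  then have "finite_dimension K W"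
    using subalbegra_incl_imp_finite_dimension[OF subfield Span_finite_dimension[OF subfield], of Us W]
      subalgebra_in_carrier[OF assms] Us assms by simp
  then show ?thesis using finite_dimensionE[OF subfield, of W] by (simp add: over_def)
qed

lemma dim_eqI: "dimension n K W \<Longrightarrow> dim K W = n"
  using dimI[OF subfield] by (simp add: over_def)

lemma dimension_subspace: "dimension n K W \<Longrightarrow> vsubspace W"
  using finite_dimension_imp_subalgebra[OF subfield] finite_dimensionI by blast

lemma finite_subspace: "vsubspace W \<Longrightarrow> finite W"
  and card_subspace: "vsubspace W \<Longrightarrow> card W = q ^ dim K W"
  using card_dimension[OF subfield finite_K subspace_dimension] by blast+

lemma dim_le:
  assumes "vsubspace W" "vsubspace Z" "W \<subseteq> Z"
  shows "dim K W \<le> dim K Z"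
  using card_mono[OF finite_subspace assms(3)] assms q_gt_1 by (simp add: card_subspace)

lemma subspace_eq:
  assumes "vsubspace W" "vsubspace Z" "W \<subseteq> Z" "dim K W = dim K Z"
  shows "W = Z"
  using card_subset_eq[OF finite_subspace[OF assms(2)] assms(3)] assms by (simp add: card_subspace)

lemma subspace_zero: "vsubspace {\<zero>}" "dim K {\<zero>} = 0"
  using dimension_subspace[OF zero_dim] dim_eqI[OF zero_dim] by auto

lemma subspaceD:
  assumes "vsubspace W"
  shows "\<zero> \<in> W" "x \<in> W \<Longrightarrow> y \<in> W \<Longrightarrow> x \<oplus> y \<in> W" "x \<in> W \<Longrightarrow> \<ominus> x \<in> W"
    "k \<in> K \<Longrightarrow> x \<in> W \<Longrightarrow> k \<otimes> x \<in> W" "x \<in> W \<Longrightarrow> x \<in> carrier L"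
proof -
  interpret W: subalgebra K W L by fact
  show "\<zero> \<in> W" "x \<in> W \<Longrightarrow> y \<in> W \<Longrightarrow> x \<oplus> y \<in> W"
    "k \<in> K \<Longrightarrow> x \<in> W \<Longrightarrow> k \<otimes> x \<in> W" "x \<in> W \<Longrightarrow> x \<in> carrier L"
    using W.one_closed W.m_closed W.smult_closed subalgebra_in_carrier[OF assms] by auto
  show "x \<in> W \<Longrightarrow> \<ominus> x \<in> W"
    using W.m_inv_closed by (simp add: a_inv_def)
qed

lemma line_extension:
  assumes Y: "vsubspace Y" and v: "v \<in> carrier L" "v \<notin> Y"
  shows "vsubspace (line_extension K v Y)" "dim K (line_extension K v Y) = Suc (dim K Y)"
    and "vsubspace Z \<Longrightarrow> line_extension K v Y \<subseteq> Z \<longleftrightarrow> Y \<subseteq> Z \<and> v \<in> Z"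
proof -
  have "dimension (Suc (dim K Y)) K (line_extension K v Y)"
    using Suc_dim[OF v subspace_dimension[OF Y]] .
  then show "vsubspace (line_extension K v Y)" "dim K (line_extension K v Y) = Suc (dim K Y)"
    using dimension_subspace dim_eqI by auto
  assume Z: "vsubspace Z"
  have "\<zero> \<in> K" "\<one> \<in> K" using subfieldE(1)[OF subfield] subringE(2,3) by auto
  show "line_extension K v Y \<subseteq> Z \<longleftrightarrow> Y \<subseteq> Z \<and> v \<in> Z"
  proof
    assume le: "line_extension K v Y \<subseteq> Z"
    have "y \<in> line_extension K v Y" if "y \<in> Y" for y
    proof -
      have "y = \<zero> \<otimes> v \<oplus> y" using subspaceD(5)[OF Y that] v by simp
      then show ?thesis using \<open>\<zero> \<in> K\<close> that by (auto simp: line_extension_mem_iff)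
    qed
    moreover have "v = \<one> \<otimes> v \<oplus> \<zero>" using v by simp
    then have "v \<in> line_extension K v Y"
      using \<open>\<one> \<in> K\<close> subspaceD(1)[OF Y] unfolding line_extension_mem_iff by blast
    ultimately show "Y \<subseteq> Z \<and> v \<in> Z" using le by blast
  next
    assume "Y \<subseteq> Z \<and> v \<in> Z"
    then show "line_extension K v Y \<subseteq> Z"
      using subspaceD(2,4)[OF Z] by (fastforce simp: line_extension_mem_iff)
  qed
qed

text \<open>Counting the pairs \<open>(v, Z)\<close> with \<open>v \<in> Z - Y\<close> reduces the codimension of \<open>Y\<close> in \<open>Z\<close>.\<close>

lemma card_subspaces_between:
  assumes "vsubspace W" "vsubspace Y" "Y \<subseteq> W"
  shows "card {Z \<in> {Z. vsubspace Z}. Y \<subseteq> Z \<and> Z \<subseteq> W \<and> dim K Z = dim K Y + m} =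
    gauss_binomial q (dim K W - dim K Y) m"
  using assms
proof (induction m arbitrary: Y)
  case 0
  have "{Z \<in> {Z. vsubspace Z}. Y \<subseteq> Z \<and> Z \<subseteq> W \<and> dim K Z = dim K Y + 0} = {Y}"
    using 0 subspace_eq[OF \<open>vsubspace Y\<close>] by fastforce
  then show ?case by simp
next
  case (Suc m)
  let ?q = "real q"
  let ?y = "dim K Y" and ?w = "dim K W"
  let ?A = "{Z \<in> {Z. vsubspace Z}. Y \<subseteq> Z \<and> Z \<subseteq> W \<and> dim K Z = ?y + Suc m}"
  have q: "?q > 1" using q_gt_1 by simp
  have finA: "finite ?A" using finite_subspaces by auto
  have finW: "finite W" using finite_subspace Suc.prems by simp
  have card_diff: "real (card (Z - Y)) = ?q ^ dim K Z - ?q ^ ?y" if "vsubspace Z" "Y \<subseteq> Z" for Z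
    using that Suc.prems card_Diff_subset[OF finite_subspace, of Y Z] dim_le[of Y Z] q_gt_1
    by (simp add: card_subspace of_nat_diff power_increasing)
  have "card ?A * (?q ^ (?y + Suc m) - ?q ^ ?y) = (\<Sum>Z\<in>?A. \<Sum>v | v \<in> W - Y \<and> v \<in> Z. 1::real)"
  proof -
    have "(\<Sum>v | v \<in> W - Y \<and> v \<in> Z. 1::real) = ?q ^ (?y + Suc m) - ?q ^ ?y" if "Z \<in> ?A" for Z
    proof -
      have "{v. v \<in> W - Y \<and> v \<in> Z} = Z - Y" using that by auto
      then show ?thesis using that card_diff[of Z] by simp
    qed
    then show ?thesis by simp
  qed
  also have "\<dots> = (\<Sum>v\<in>W - Y. \<Sum>Z | Z \<in> ?A \<and> v \<in> Z. 1)"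
    using finA finW by (intro sum.swap_restrict) auto
  also have "\<dots> = (\<Sum>v\<in>W - Y. gauss_binomial q (?w - ?y - 1) m)"
  proof (rule sum.cong[OF refl])
    fix v assume v: "v \<in> W - Y"
    then have v': "v \<in> carrier L" "v \<notin> Y" using Suc.prems subspaceD(5) by auto
    let ?Y = "line_extension K v Y"
    note ext = line_extension[OF Suc.prems(2) v']
    \<comment> \<open>A space contains \<open>Y\<close> and \<open>v\<close> exactly if it contains
      \<open>?Y\<close>, so only \<open>m\<close> further dimensions remain.\<close>
    have "{Z. Z \<in> ?A \<and> v \<in> Z} = {Z \<in> {Z. vsubspace Z}. ?Y \<subseteq> Z \<and> Z \<subseteq> W \<and> dim K Z = dim K ?Y + m}"
      using ext by auto
    then show "(\<Sum>Z | Z \<in> ?A \<and> v \<in> Z. 1) = gauss_binomial q (?w - ?y - 1) m"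
      using Suc.IH[OF Suc.prems(1) ext(1)] ext(2,3) Suc.prems v by simp
  qed
  also have "\<dots> = gauss_binomial q (?w - ?y - 1) m * (?q ^ ?w - ?q ^ ?y)"
    using card_diff Suc.prems by simp
  also have "?q ^ ?w - ?q ^ ?y = ?q ^ ?y * (?q ^ (?w - ?y) - 1)"
    using dim_le Suc.prems by (simp add: algebra_simps flip: power_add)
  also have "gauss_binomial q (?w - ?y - 1) m * (?q ^ ?y * (?q ^ (?w - ?y) - 1)) =
      gauss_binomial q (?w - ?y) (Suc m) * (?q ^ (?y + Suc m) - ?q ^ ?y)"
  proof -
    have "?q ^ (?y + Suc m) - ?q ^ ?y = ?q ^ ?y * (?q ^ Suc m - 1)"
      by (simp add: power_add right_diff_distrib)
    then show ?thesis
      using gauss_binomial_absorb[OF q, of "Suc m" "?w - ?y"]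
      by (simp only: mult.left_commute[of _ "?q ^ ?y"] zero_less_Suc diff_Suc_1)
  qed
  finally have "card ?A * (?q ^ (?y + Suc m) - ?q ^ ?y) =
      gauss_binomial q (?w - ?y) (Suc m) * (?q ^ (?y + Suc m) - ?q ^ ?y)" .
  moreover have "?q ^ (?y + Suc m) \<noteq> ?q ^ ?y"
    using power_strict_increasing[OF _ q, of ?y "?y + Suc m"] by simp
  ultimately show ?case by simp
qed

lemma subspace_l_coset:
  assumes s: "s \<in> carrier L" "s \<noteq> \<zero>" and W: "vsubspace W"
  shows "vsubspace (s <# W)" "dim K (s <# W) = dim K W"
proof -
  note W' = subspaceD[OF W]
  have s_eq: "s <# W = (\<lambda>x. s \<otimes> x) ` W" by (auto simp: l_coset_def)
  show sub: "vsubspace (s <# W)"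
  proof (intro subalgebra.intro subalgebra_axioms.intro add.subgroupI)
    show "s <# W \<subseteq> carrier L" using W'(5) s(1) by (auto simp: s_eq)
    show "s <# W \<noteq> {}" using W'(1) by (auto simp: s_eq)
  next
    fix x y assume "x \<in> s <# W" "y \<in> s <# W"
    then obtain u v where uv: "u \<in> W" "v \<in> W" "x = s \<otimes> u" "y = s \<otimes> v" by (auto simp: s_eq)
    then have "x \<oplus> y = s \<otimes> (u \<oplus> v)" using W'(5) s(1) by (simp add: r_distr)
    then show "x \<oplus> y \<in> s <# W" using W'(2)[OF uv(1,2)] by (auto simp: s_eq)
  next
    fix x assume "x \<in> s <# W"
    then obtain w where w: "w \<in> W" "x = s \<otimes> w" by (auto simp: s_eq)
    then have "\<ominus> x = s \<otimes> (\<ominus> w)" using W'(5) s(1) by (simp add: r_minus)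
    then show "\<ominus> x \<in> s <# W" using W'(3)[OF w(1)] by (auto simp: s_eq)
  next
    fix k x assume k: "k \<in> K" and "x \<in> s <# W"
    then obtain w where w: "w \<in> W" "x = s \<otimes> w" by (auto simp: s_eq)
    then have "k \<otimes> x = s \<otimes> (k \<otimes> w)" using W'(5) s(1) k K_subset m_lcomm by auto
    then show "k \<otimes> x \<in> s <# W" using W'(4)[OF k w(1)] by (auto simp: s_eq)
  qed
  have "inj_on (\<lambda>x. s \<otimes> x) W"
    using s W'(5) m_lcancel by (auto simp: inj_on_def)
  then have "card (s <# W) = card W" by (simp add: s_eq card_image)
  then show "dim K (s <# W) = dim K W"
    using sub W q_gt_1 by (simp add: card_subspace)
qed

end

section \<open>Multiplication by a generator of the extension\<close>

locale simple_extension = finite_field_extension +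
  fixes \<sigma> :: 'a
  assumes \<sigma>_in: "\<sigma> \<in> carrier L" and generate: "generate_field L (insert \<sigma> K) = carrier L"
    and proper: "K \<noteq> carrier L"
begin

text \<open>The multipliers that preserve \<open>W\<close> include \<open>K\<close> and
  \<open>\<sigma>\<close> and are closed under the field operations.\<close>

lemma generated_stable:
  assumes W: "vsubspace W" and \<sigma>W: "\<And>w. w \<in> W \<Longrightarrow> \<sigma> \<otimes> w \<in> W"
    and x: "x \<in> carrier L" and w: "w \<in> W"
  shows "x \<otimes> w \<in> W"
proof -
  note W' = subspaceD[OF W]
  have "x \<in> generate_field L (insert \<sigma> K)" using x generate by simp
  then have "x \<in> carrier L \<and> (\<forall>w\<in>W. x \<otimes> w \<in> W)"
  proof (induction rule: generate_field.induct)
    case one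
    show ?case using W'(5) by simp
  next
    case (incl h)
    then show ?case using W'(4) \<sigma>W \<sigma>_in K_subset by blast
  next
    case (a_inv h)
    then show ?case using W'(3,5) by (simp add: l_minus)
  next
    case (eng_add h1 h2)
    then show ?case using W'(2,5) by (simp add: l_distr)
  next
    case (eng_mult h1 h2)
    then show ?case using W'(5) by (simp add: m_assoc)
  next
    case (m_inv h)
    then have h: "h \<in> Units L" by (simp add: field_Units)
    \<comment> \<open>Multiplication by \<open>h\<close> is injective on the finite
      \<open>W\<close>, hence onto, so the inverse preserves \<open>W\<close> too.\<close>
    have "(\<lambda>w. h \<otimes> w) ` W = W"
    proof (rule card_subset_eq[OF finite_subspace[OF W]])
      show "card ((\<lambda>w. h \<otimes> w) ` W) = card W"
        using W'(5) m_inv m_lcancel by (intro card_image) (simp add: inj_on_def)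
    qed (use m_inv in auto)
    moreover have "inv h \<otimes> (h \<otimes> w) = w" if "w \<in> W" for w
      using that W'(5) h by (simp add: Units_closed flip: m_assoc)
    ultimately have "inv h \<otimes> w \<in> W" if "w \<in> W" for w using that by (metis imageE)
    then show ?case using h by simp
  qed
  then show ?thesis using w by blast
qed

text \<open>Otherwise \<open>K\<close> would be stable under \<open>\<sigma>\<close>, hence under
  all of \<open>L\<close>, and \<open>\<one> \<in> K\<close> would give
  \<open>K = L\<close>.\<close>

lemma \<sigma>_nonzero: "\<sigma> \<noteq> \<zero>"
proof
  assume "\<sigma> = \<zero>"
  have K: "vsubspace K"
    using dimension_subspace[OF dimension_one[OF subfield]] .
  have "x \<in> K" if "x \<in> carrier L" for x
    using generated_stable[OF K _ that, of \<one>] that subspaceD[OF K] \<open>\<sigma> = \<zero>\<close>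
      subringE(3)[OF subfieldE(1)[OF subfield]] by auto
  then show False using proper K_subset by auto
qed

lemma \<sigma>_Units: "\<sigma> \<in> Units L"
  using \<sigma>_in \<sigma>_nonzero by (simp add: field_Units)

definition "preim_part W = W \<inter> (inv \<sigma> <# W)"
definition "image_sum W = W <+>\<^bsub>L\<^esub> (\<sigma> <# W)"

lemma mem_preim_part:
  assumes "vsubspace W"
  shows "x \<in> preim_part W \<longleftrightarrow> x \<in> W \<and> \<sigma> \<otimes> x \<in> W"
proof -
  have "\<sigma> \<otimes> (inv \<sigma> \<otimes> y) = y" "inv \<sigma> \<otimes> (\<sigma> \<otimes> y) = y" if "y \<in> carrier L" for y
    using that \<sigma>_Units \<sigma>_in by (simp_all flip: m_assoc)
  then show ?thesis
    using subspaceD(5)[OF assms] unfolding preim_part_def l_coset_def by force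
qed

lemma subspace_preim_part: "vsubspace W \<Longrightarrow> vsubspace (preim_part W)"
  unfolding preim_part_def
  using subspace_l_coset[of "inv \<sigma>" W] \<sigma>_Units \<sigma>_nonzero subalgebra_inter
  by (metis Units_inv_Units Units_closed field_Units DiffE singletonI)

lemma image_sum_subset_iff:
  assumes W: "vsubspace W" and Y: "vsubspace Y"
  shows "image_sum Y \<subseteq> W \<longleftrightarrow> Y \<subseteq> preim_part W"
proof
  assume le: "image_sum Y \<subseteq> W"
  have mem: "x \<oplus> \<sigma> \<otimes> y \<in> W" if "x \<in> Y" "y \<in> Y" for x y
    using le that unfolding image_sum_def set_add_def' l_coset_def by blast
  have "x \<in> W" "\<sigma> \<otimes> x \<in> W" if "x \<in> Y" for x
    using mem[of x \<zero>] mem[of \<zero> x] that subspaceD[OF Y] \<sigma>_in by simp_all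
  then show "Y \<subseteq> preim_part W" using mem_preim_part[OF W] by blast
next
  assume "Y \<subseteq> preim_part W"
  then show "image_sum Y \<subseteq> W"
    using mem_preim_part[OF W] subspaceD(2)[OF W]
    unfolding image_sum_def set_add_def' l_coset_def by blast
qed

text \<open>The dimension formula for sums applies: \<open>W \<inter> \<sigma> W\<close> is the
  image of \<open>preim_part W\<close> under multiplication by \<open>\<sigma>\<close>, so it has
  the same dimension.\<close>

lemma image_sum:
  assumes W: "vsubspace W"
  shows "vsubspace (image_sum W)" "dim K (image_sum W) = 2 * dim K W - dim K (preim_part W)"
proof -
  note \<sigma> = subspace_l_coset[OF \<sigma>_in \<sigma>_nonzero]
  have "W \<inter> (\<sigma> <# W) = \<sigma> <# preim_part W"
    using mem_preim_part[OF W] unfolding l_coset_def by auto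
  then have "dimension (dim K (preim_part W)) K (W \<inter> (\<sigma> <# W))"
    using subspace_dimension[OF \<sigma>(1)] \<sigma>(2) subspace_preim_part[OF W] by metis
  then have "dimension (dim K W + dim K W - dim K (preim_part W)) K (image_sum W)"
    unfolding image_sum_def
    using dimension_sum_space[OF subfield subspace_dimension[OF W] subspace_dimension[OF \<sigma>(1)[OF W]]]
      \<sigma>(2)[OF W] by simp
  then show "vsubspace (image_sum W)" "dim K (image_sum W) = 2 * dim K W - dim K (preim_part W)"
    using dimension_subspace dim_eqI by (auto simp: mult_2)
qed

text \<open>Equality would make \<open>W\<close> stable under \<open>\<sigma>\<close>, hence under
  all of \<open>L\<close>; a nonzero \<open>w \<in> W\<close> would then give
  \<open>L = L w \<subseteq> W\<close>.\<close>

lemma dim_preim_part: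
  assumes W: "vsubspace W" and "0 < dim K W" "dim K W < dim K (carrier L)"
  shows "dim K (preim_part W) < dim K W"
proof -
  have le: "preim_part W \<subseteq> W" by (simp add: preim_part_def)
  have "dim K (preim_part W) \<noteq> dim K W"
  proof
    assume "dim K (preim_part W) = dim K W"
    then have eq: "preim_part W = W" using subspace_eq[OF subspace_preim_part W le] W by simp
    then have stable: "\<sigma> \<otimes> w \<in> W" if "w \<in> W" for w using mem_preim_part[OF W] that by blast
    have "W \<noteq> {\<zero>}" using assms(2) subspace_zero(2) by auto
    then obtain w where w: "w \<in> W" "w \<noteq> \<zero>" using subspaceD(1)[OF W] by blast
    then have wU: "w \<in> Units L" using subspaceD(5)[OF W] by (simp add: field_Units)
    have "x \<in> W" if "x \<in> carrier L" for x
    proof -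
      have "(x \<otimes> inv w) \<otimes> w \<in> W"
        using generated_stable[OF W stable _ w(1)] that wU by simp
      moreover have "(x \<otimes> inv w) \<otimes> w = x" using that wU by (simp add: m_assoc Units_closed)
      ultimately show ?thesis by simp
    qed
    then have "W = carrier L" using subspaceD(5)[OF W] by blast
    then show False using assms(3) by simp
  qed
  then show ?thesis using dim_le[OF subspace_preim_part W le] W by simp
qed

sublocale lattice: simple_operator_lattice "{W. vsubspace W}" "dim K" preim_part image_sum
  "carrier L" "dim K (carrier L)" "real q"
proof
  show "preim_part (carrier L) = carrier L"
    using mem_preim_part[OF subspace_carrier] \<sigma>_in by blast
  show "real (card {Z \<in> {W. vsubspace W}. Z \<subseteq> W \<and> dim K Z = a}) = gauss_binomial (real q) (dim K W) a"
    if "W \<in> {W. vsubspace W}" for W a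
  proof -
    have "{Z \<in> {W. vsubspace W}. Z \<subseteq> W \<and> dim K Z = a} =
        {Z \<in> {W. vsubspace W}. {\<zero>} \<subseteq> Z \<and> Z \<subseteq> W \<and> dim K Z = dim K {\<zero>} + a}"
      using subspaceD(1) subspace_zero(2) by auto
    then show ?thesis
      using card_subspaces_between[of W "{\<zero>}" a] that subspaceD(1) subspace_zero by simp
  qed
  show "real (card {Z \<in> {W. vsubspace W}. Y \<subseteq> Z \<and> Z \<subseteq> W \<and> dim K Z = a}) =
      gauss_binomial (real q) (dim K W - dim K Y) (a - dim K Y)"
    if "W \<in> {W. vsubspace W}" "Y \<in> {W. vsubspace W}" "Y \<subseteq> W" "dim K Y \<le> a" for W Y a
    using card_subspaces_between[of W Y "a - dim K Y"] that by simp
qed (use q_gt_1 finite_subspaces subspace_carrier subspace_preim_part image_sum image_sum_subset_iff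
  dim_le dim_preim_part in auto)

end

section \<open>The count for the field extension\<close>

context simple_extension
begin

lemma mem_subspaces_of_type:
  "W \<in> subspaces_of_type L K \<sigma> a b \<longleftrightarrow> vsubspace W \<and> dim K W = a \<and> dim K (preim_part W) = b"
  by (simp add: subspaces_of_type_def preim_part_def)

text \<open>The first member has no predecessor in \<open>subspace_chains\<close>; in
  \<open>lattice.chains\<close> its predecessor is the whole field, which \<open>preim_part\<close>
  fixes.\<close>

lemma subspace_chains_eq:
  "subspace_chains L \<sigma> (map (\<lambda>i. subspaces_of_type L K \<sigma> (a i) (b i)) js) =
    lattice.chains (carrier L) (map (\<lambda>i. (a i, b i)) js)"
proof (rule Set.set_eqI)
  fix Ws
  let ?n = "length js"
  have "(\<forall>i. Suc i < ?n \<longrightarrow> image_sum (Ws ! Suc i) \<subseteq> Ws ! i) \<longleftrightarrow>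
      (\<forall>i < ?n. Ws ! i \<subseteq> preim_part ((carrier L # Ws) ! i))" (is "?l \<longleftrightarrow> ?r")
    if types: "\<And>i. i < ?n \<Longrightarrow> vsubspace (Ws ! i)"
  proof
    assume ?l
    show ?r
    proof (intro allI impI)
      fix i assume "i < ?n"
      then show "Ws ! i \<subseteq> preim_part ((carrier L # Ws) ! i)"
        using \<open>?l\<close> types subalgebra_in_carrier[OF types] image_sum_subset_iff lattice.D_V by (cases i) simp_all
    qed
  next
    assume ?r
    show ?l
    proof (intro allI impI)
      fix i assume "Suc i < ?n"
      then show "image_sum (Ws ! Suc i) \<subseteq> Ws ! i"
        using \<open>?r\<close> types[of i] types[of "Suc i"] image_sum_subset_iff by fastforce
    qed
  qed
  then show "Ws \<in> subspace_chains L \<sigma> (map (\<lambda>i. subspaces_of_type L K \<sigma> (a i) (b i)) js) \<longleftrightarrow>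
      Ws \<in> lattice.chains (carrier L) (map (\<lambda>i. (a i, b i)) js)"
    unfolding subspace_chains_def lattice.chains_iff
    by (simp add: mem_subspaces_of_type flip: image_sum_def) blast
qed

lemma card_subspace_chains:
  assumes "N = dim K (carrier L)" "a1 0 = N" "a2 0 = N" "r \<ge> 1" "N > a1 1" "a1 (r + 1) = 0"
    and "\<And>i. 1 \<le> i \<Longrightarrow> i \<le> r \<Longrightarrow> a1 i > a2 i"
  shows "real (card (subspace_chains L \<sigma>
                  (map (\<lambda>i. subspaces_of_type L K \<sigma> (a1 i) (a2 i)) [1..<r + 1]))) =
    gauss_binomial q N 1 / gauss_binomial q (a1 1) 1 *
    ((\<Prod>i = 0..r - 1.
        gauss_binomial q (a1 i - a1 (i + 1) - 1) (a1 (i + 1) - a2 (i + 1) - 1) *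
        gauss_binomial q (a1 (i + 1)) (a2 (i + 1)) *
        gauss_binomial q (a2 (i + 1)) (a1 (i + 2))) /
     (\<Prod>i = 1..r - 1. gauss_binomial q (a1 i - 1) (a1 (i + 1) - 1))) *
    real q ^ (\<Sum>i = 1..r. (a1 i - a2 i) * (a1 i - a2 i - 1))"
proof -
  let ?ts = "map (\<lambda>i. (a1 i, a2 i)) [1..<r + 1]"
  have ts: "?ts = (a1 1, a2 1) # map (\<lambda>i. (a1 i, a2 i)) [2..<r + 1]"
    using \<open>r \<ge> 1\<close> by (subst upt_conv_Cons) (auto simp: numeral_2_eq_2)
  have "proper_types ?ts"
    using assms(7) by (auto simp: proper_types_def simp del: upt_Suc)
  then have "lattice.num (carrier L) ?ts = chain_weight q N N ?ts"
    unfolding ts assms(1) using assms(1,5) by (intro lattice.num_top) simp_all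
  moreover have "0 < a1 1" using assms(7)[of 1] \<open>r \<ge> 1\<close> by simp
  ultimately show ?thesis
    unfolding subspace_chains_eq lattice.card_chains
    using chain_weight_closed_form[of q a1 N a2 r] assms(2-6) q_gt_1 by simp
qed

end

theorem theorem3p3:
  fixes L :: "('a, 'b) ring_scheme" and K :: "'a set" and \<sigma> :: 'a
    and q N r :: nat and a1 a2 :: "nat \<Rightarrow> nat"
  assumes "primepow q" and "N > 0"
    and "field L" and "card (carrier L) = q ^ N"
    and "subfield K L" and "card K = q"
    and "\<sigma> \<in> carrier L" and "generate_field L (insert \<sigma> K) = carrier L"
    and "r \<ge> 1"
    and "N > a1 1"
    and "\<And>i. 1 \<le> i \<Longrightarrow> i \<le> r \<Longrightarrow> a1 i > a2 i"
    and "\<And>i. 1 \<le> i \<Longrightarrow> i < r \<Longrightarrow> a2 i \<ge> a1 (i + 1)"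
    and "a1 0 = N" and "a2 0 = N"
    and "a1 (r + 1) = 0" and "a2 (r + 1) = 0"
  shows "real (card (subspace_chains L \<sigma>
                  (map (\<lambda>i. subspaces_of_type L K \<sigma> (a1 i) (a2 i)) [1..<r + 1]))) =
    gauss_binomial q N 1 / gauss_binomial q (a1 1) 1 *
    ((\<Prod>i = 0..r - 1.
        gauss_binomial q (a1 i - a1 (i + 1) - 1) (a1 (i + 1) - a2 (i + 1) - 1) *
        gauss_binomial q (a1 (i + 1)) (a2 (i + 1)) *
        gauss_binomial q (a2 (i + 1)) (a1 (i + 2))) /
     (\<Prod>i = 1..r - 1. gauss_binomial q (a1 i - 1) (a1 (i + 1) - 1))) *
    real q ^ (\<Sum>i = 1..r. (a1 i - a2 i) * (a1 i - a2 i - 1))"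
proof -
  interpret field L by fact
  have q: "q > 1" using primepow_gt_Suc_0[OF \<open>primepow q\<close>] by simp
  \<comment> \<open>An infinite set has cardinality 0, so the positive value \<open>q ^ N\<close>
    gives finiteness.\<close>
  have fin: "finite (carrier L)"
    using \<open>card (carrier L) = q ^ N\<close> q by (intro card_ge_0_finite) simp
  interpret F: finite_field_extension L K
    by (intro finite_field_extension.intro finite_field_extension_axioms.intro) fact+
  have a: "0 < a1 1" using assms(9) assms(11)[of 1] by simp
  \<comment> \<open>\<open>N > a1 1 > 0\<close> gives \<open>N \<ge> 2\<close>, so \<open>K\<close>
    is smaller than \<open>L\<close>.\<close>
  have proper: "K \<noteq> carrier L"
  proof
    assume "K = carrier L"
    then have "q ^ 1 = q ^ N" using assms(4,6) by simp
    then show False using power_inject_exp[of q 1 N] q a assms(10) by simp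
  qed
  interpret F: simple_extension L K \<sigma>
    by (intro simple_extension.intro simple_extension_axioms.intro F.finite_field_extension_axioms) fact+
  have dim: "dim K (carrier L) = N"
    using F.card_subspace[OF F.subspace_carrier] assms(4,6) q by simp
  show ?thesis
    using F.card_subspace_chains[of N a1 a2 r] dim assms(6,9-11,13-15) by simp
qed

end
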